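(* The varieties $\mathcal{SL}$, $\mathcal A_{12}$, $\mathcal A_{23}$, $\mathcal F_{25}$ and $\mathcal S$ are nontrivial and pairwise distinct, and they satisfy: (a) $\mathcal{SL}\subsetneq \mathcal A_{23}\subsetneq \mathcal F_{25}$; (b) $\mathcal{SL}\subsetneq\mathcal A_{12}$; (c) $\mathcal{BA}\subsetneq\mathcal A_{12}\subsetneq\mathcal F_{25}$; (d) $\mathcal F_{25}\subsetneq \mathcal S$; (e) $\mathcal{SL}=\mathcal A_{23}\cap\mathcal A_{12}$.
   Context: A zroupoid is an algebra $\langle A,\to,0\rangle$ with $\to$ binary and $0$ a constant; write $x' := x\to 0$. An implication zroupoid ($\mathcal I$-zroupoid) is a zroupoid satisfying (I) $(x\to y)\to z \approx ((z'\to x)\to(y\to z)')'$ and (I$_0$) $0''\approx 0$. Let $\mathcal S$ be the variety of $\mathcal I$-zroupoids satisfying $x''\approx x$ and $(x\to y')'\approx (y\to x')'$. $\mathcal{SL}$ is the variety of $\mathcal I$-zroupoids satisfying $x'\approx x$ and $x\to y\approx y\to x$. $\mathcal{BA}$ is the variety of $\mathcal I$-zroupoids satisfying $(x\to y)\to x\approx x$ and $x\to x\approx 0'$ (term-equivalent to Boolean algebras; it is generated by the two-element algebra on $\{0,1\}$ with $0\to0=0\to1=1\to1=1$, $1\to0=0$). Bol-Moufang identities used: $(A_{12})$: $x\to(x\to(y\to z))\approx x\to((x\to y)\to z)$; $(A_{23})$: $x\to((x\to y)\to z)\approx (x\to x)\to(y\to z)$; $(F_{25})$: $x\to((y\to z)\to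 z)\approx ((x\to y)\to z)\to z$. For $X_{ij}$ among these, $\mathcal X_{ij}$ denotes the subvariety of $\mathcal S$ defined by $(X_{ij})$. *)

theory Defs
  imports "HOL-Library.Infinite_Typeclass"
begin

record 'a zroupoid =
  carrier :: "'a set"
  imp :: "'a \<Rightarrow> 'a \<Rightarrow> 'a"  (infixl \<open>\<rightarrow>\<index>\<close> 65)
  zero :: 'a  (\<open>\<zero>\<index>\<close>)

definition neg :: "('a, 'b) zroupoid_scheme \<Rightarrow> 'a \<Rightarrow> 'a"  (\<open>(_\<acute>\<index>)\<close> [1000] 1000) where
  "neg A x = imp A x (zero A)"

definition is_zroupoid :: "'a zroupoid \<Rightarrow> bool" where
  "is_zroupoid A \<longleftrightarrow>
     zero A \<in> carrier A \<and> (\<forall>x\<in>carrier A. \<forall>y\<in>carrier A. imp A x y \<in> carrier A)"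

definition is_I_zroupoid :: "'a zroupoid \<Rightarrow> bool" where
  "is_I_zroupoid A \<longleftrightarrow> is_zroupoid A \<and>
     (\<forall>x\<in>carrier A. \<forall>y\<in>carrier A. \<forall>z\<in>carrier A.
        (x \<rightarrow>\<^bsub>A\<^esub> y) \<rightarrow>\<^bsub>A\<^esub> z =
          ((z\<acute>\<^bsub>A\<^esub> \<rightarrow>\<^bsub>A\<^esub> x) \<rightarrow>\<^bsub>A\<^esub> (y \<rightarrow>\<^bsub>A\<^esub> z)\<acute>\<^bsub>A\<^esub>)\<acute>\<^bsub>A\<^esub>) \<and>
     \<zero>\<^bsub>A\<^esub>\<acute>\<^bsub>A\<^esub>\<acute>\<^bsub>A\<^esub> = \<zero>\<^bsub>A\<^esub>"

text \<open>
  A variety is rendered as the set of its members whose carrier is a subset of the type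
  \<open>'a\<close>. Membership depends only on the operation restricted to the carrier and is invariant
  under isomorphism. When \<open>'a\<close> is infinite, every countable algebra has an isomorphic copy
  over \<open>'a\<close>; since a variety is determined by its countable members, inclusion and
  equality of varieties coincide with inclusion and equality of these sets.
\<close>

definition var_S :: "'a zroupoid set" where
  "var_S = {A. is_I_zroupoid A \<and>
     (\<forall>x\<in>carrier A. x\<acute>\<^bsub>A\<^esub>\<acute>\<^bsub>A\<^esub> = x) \<and>
     (\<forall>x\<in>carrier A. \<forall>y\<in>carrier A.
        (x \<rightarrow>\<^bsub>A\<^esub> y\<acute>\<^bsub>A\<^esub>)\<acute>\<^bsub>A\<^esub> = (y \<rightarrow>\<^bsub>A\<^esub> x\<acute>\<^bsub>A\<^esub>)\<acute>\<^bsub>A\<^esub>)}"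

definition var_SL :: "'a zroupoid set" where
  "var_SL = {A. is_I_zroupoid A \<and>
     (\<forall>x\<in>carrier A. x\<acute>\<^bsub>A\<^esub> = x) \<and>
     (\<forall>x\<in>carrier A. \<forall>y\<in>carrier A. x \<rightarrow>\<^bsub>A\<^esub> y = y \<rightarrow>\<^bsub>A\<^esub> x)}"

definition var_BA :: "'a zroupoid set" where
  "var_BA = {A. is_I_zroupoid A \<and>
     (\<forall>x\<in>carrier A. \<forall>y\<in>carrier A. (x \<rightarrow>\<^bsub>A\<^esub> y) \<rightarrow>\<^bsub>A\<^esub> x = x) \<and>
     (\<forall>x\<in>carrier A. x \<rightarrow>\<^bsub>A\<^esub> x = \<zero>\<^bsub>A\<^esub>\<acute>\<^bsub>A\<^esub>)}"

definition var_A12 :: "'a zroupoid set" where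
  "var_A12 = {A \<in> var_S.
     \<forall>x\<in>carrier A. \<forall>y\<in>carrier A. \<forall>z\<in>carrier A.
        x \<rightarrow>\<^bsub>A\<^esub> (x \<rightarrow>\<^bsub>A\<^esub> (y \<rightarrow>\<^bsub>A\<^esub> z)) = x \<rightarrow>\<^bsub>A\<^esub> ((x \<rightarrow>\<^bsub>A\<^esub> y) \<rightarrow>\<^bsub>A\<^esub> z)}"

definition var_A23 :: "'a zroupoid set" where
  "var_A23 = {A \<in> var_S.
     \<forall>x\<in>carrier A. \<forall>y\<in>carrier A. \<forall>z\<in>carrier A.
        x \<rightarrow>\<^bsub>A\<^esub> ((x \<rightarrow>\<^bsub>A\<^esub> y) \<rightarrow>\<^bsub>A\<^esub> z) = (x \<rightarrow>\<^bsub>A\<^esub> x) \<rightarrow>\<^bsub>A\<^esub> (y \<rightarrow>\<^bsub>A\<^esub> z)}"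

definition var_F25 :: "'a zroupoid set" where
  "var_F25 = {A \<in> var_S.
     \<forall>x\<in>carrier A. \<forall>y\<in>carrier A. \<forall>z\<in>carrier A.
        x \<rightarrow>\<^bsub>A\<^esub> ((y \<rightarrow>\<^bsub>A\<^esub> z) \<rightarrow>\<^bsub>A\<^esub> z) = ((x \<rightarrow>\<^bsub>A\<^esub> y) \<rightarrow>\<^bsub>A\<^esub> z) \<rightarrow>\<^bsub>A\<^esub> z}"

definition nontrivial :: "'a zroupoid set \<Rightarrow> bool" where
  "nontrivial V \<longleftrightarrow> (\<exists>A\<in>V. \<exists>x\<in>carrier A. \<exists>y\<in>carrier A. x \<noteq> y)"

end

theory Submission
  imports Defs
begin

text \<open>
  In a member of \<open>\<S>\<close> put \<open>x \<squnion> y = x' \<rightarrow> y\<close> and \<open>x \<sqinter> y = (x \<rightarrow> y')'\<close>. These are commutative, exchanged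
  by the involution, have units \<open>0\<close> and \<open>0'\<close>, and (I) says that they distribute over each other.
  Such operations are idempotent and, with more work, associative, even though absorption may fail:
  \<open>x \<sqinter> (x \<squnion> y) = x \<squnion> x \<sqinter> y = x \<squnion> 0 \<sqinter> y\<close> behaves like the partition function of a Plonka sum.
  In this language (\<open>A\<^sub>1\<^sub>2\<close>) reads \<open>x \<squnion> x' \<sqinter> y = x \<squnion> y\<close>, (\<open>A\<^sub>2\<^sub>3\<close>) reads
  \<open>x \<squnion> x' \<sqinter> y = x \<sqinter> x' \<squnion> y\<close>, and (\<open>F\<^sub>2\<^sub>5\<close>) reads
  \<open>x \<squnion> (z \<squnion> z' \<sqinter> y) = (z \<squnion> z' \<sqinter> x) \<squnion> (z \<squnion> z' \<sqinter> y)\<close>, so that the inclusions become semilattice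
  computations; together (\<open>A\<^sub>1\<^sub>2\<close>) and (\<open>A\<^sub>2\<^sub>3\<close>) at \<open>y = 0\<close> give \<open>x = x \<sqinter> x'\<close>, hence \<open>x = x'\<close>.
  Strictness is witnessed by algebras with at most four elements.
\<close>

text \<open>Call the two sides \<open>a\<close> and \<open>b\<close>. Self-distributivity and
  absorption give \<open>f a p = b\<close> and \<open>f b r = a\<close>. Absorption then yields
  \<open>f a b = b\<close> and \<open>f b a = a\<close>, and commutativity identifies them.\<close>

lemma self_distributive_assoc:
  assumes closed: "\<And>p q. \<lbrakk>p \<in> D; q \<in> D\<rbrakk> \<Longrightarrow> f p q \<in> D"
    and comm: "\<And>p q. \<lbrakk>p \<in> D; q \<in> D\<rbrakk> \<Longrightarrow> f p q = f q p"
    and absorb: "\<And>p q. \<lbrakk>p \<in> D; q \<in> D\<rbrakk> \<Longrightarrow> f p (f p q) = f p q"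
    and dist: "\<And>p q r. \<lbrakk>p \<in> D; q \<in> D; r \<in> D\<rbrakk> \<Longrightarrow> f p (f q r) = f (f p q) (f p r)"
    and D: "p \<in> D" "q \<in> D" "r \<in> D"
  shows "f (f p q) r = f p (f q r)"
proof -
  let ?a = "f (f p q) r" and ?b = "f p (f q r)"
  have cl: "f p q \<in> D" "f q r \<in> D" "?a \<in> D" "?b \<in> D"
    using D closed by blast+
  have "f ?a p = f p ?a"
    using cl D comm by blast
  also have "\<dots> = f (f p (f p q)) (f p r)"
    using cl D dist by blast
  also have "\<dots> = ?b"
    using D by (simp add: absorb dist)
  finally have ap: "f ?a p = ?b" .
  have "f ?b r = f r ?b"
    using cl D comm by blast
  also have "\<dots> = f (f r p) (f r (f r q))"
    using cl D dist[of r p "f q r"] comm[of q r] by simp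
  also have "\<dots> = f r (f p q)"
    using D by (simp add: absorb dist)
  also have "\<dots> = ?a"
    using cl D comm by blast
  finally have br: "f ?b r = ?a" .
  have "f ?a ?b = ?b"
    using absorb[of ?a p] ap cl D by simp
  moreover have "f ?b ?a = ?a"
    using absorb[of ?b r] br cl D by simp
  ultimately show ?thesis
    using comm cl by metis
qed

section \<open>Distributive bisemilattices with units: associativity derived\<close>

locale weak_bisemilattice =
  fixes C :: "'a set"
    and join :: "'a \<Rightarrow> 'a \<Rightarrow> 'a" (infixl \<open>\<squnion>\<close> 65)
    and meet :: "'a \<Rightarrow> 'a \<Rightarrow> 'a" (infixl \<open>\<sqinter>\<close> 70)
    and bot :: 'a (\<open>\<bottom>\<close>)
    and top :: 'a (\<open>\<top>\<close>)
  assumes join_closed [simp]: "\<lbrakk>x \<in> C; y \<in> C\<rbrakk> \<Longrightarrow> x \<squnion> y \<in> C"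
    and meet_closed [simp]: "\<lbrakk>x \<in> C; y \<in> C\<rbrakk> \<Longrightarrow> x \<sqinter> y \<in> C"
    and bot_closed [simp]: "\<bottom> \<in> C"
    and top_closed [simp]: "\<top> \<in> C"
    and join_comm: "\<lbrakk>x \<in> C; y \<in> C\<rbrakk> \<Longrightarrow> x \<squnion> y = y \<squnion> x"
    and meet_comm: "\<lbrakk>x \<in> C; y \<in> C\<rbrakk> \<Longrightarrow> x \<sqinter> y = y \<sqinter> x"
    and join_bot [simp]: "x \<in> C \<Longrightarrow> x \<squnion> \<bottom> = x"
    and meet_top [simp]: "x \<in> C \<Longrightarrow> x \<sqinter> \<top> = x"
    and join_meet_distrib: "\<lbrakk>x \<in> C; y \<in> C; z \<in> C\<rbrakk> \<Longrightarrow> x \<squnion> y \<sqinter> z = (x \<squnion> y) \<sqinter> (x \<squnion> z)"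
    and meet_join_distrib: "\<lbrakk>x \<in> C; y \<in> C; z \<in> C\<rbrakk> \<Longrightarrow> x \<sqinter> (y \<squnion> z) = x \<sqinter> y \<squnion> x \<sqinter> z"
begin

sublocale dual: weak_bisemilattice C "(\<sqinter>)" "(\<squnion>)" "\<top>" "\<bottom>"
  by unfold_locales (auto intro: join_comm meet_comm join_meet_distrib meet_join_distrib)

lemma bot_join [simp]: "x \<in> C \<Longrightarrow> \<bottom> \<squnion> x = x"
  using join_comm[of \<bottom> x] by simp

text \<open>Distribute \<open>\<top> \<squnion> _\<close> over
  \<open>\<bottom> \<sqinter> \<top> = \<bottom>\<close>. Idempotence follows on meeting this
  equation with \<open>x\<close>.\<close>

lemma top_join_top: "\<top> \<squnion> \<top> = \<top>"
  using join_meet_distrib[of \<top> \<bottom> \<top>] meet_comm[of \<top> "\<top> \<squnion> \<top>"] by simp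

lemma join_idem [simp]: "x \<in> C \<Longrightarrow> x \<squnion> x = x"
  using meet_join_distrib[of x \<top> \<top>] by (simp add: top_join_top)

end

\<comment> \<open>Reopening the locale activates the dual copies of the simp rules above.\<close>
context weak_bisemilattice
begin

text \<open>In a bounded lattice \<open>up\<close> and \<open>down\<close> are constant. Without
  absorption they give the greatest and the least element of the Plonka fibre of \<open>x\<close>,
  so each serves as a label of that fibre.\<close>

definition up :: "'a \<Rightarrow> 'a" where "up x = \<top> \<squnion> x"
definition down :: "'a \<Rightarrow> 'a" where "down x = \<bottom> \<sqinter> x"

text \<open>
  In the Plonka sum decomposition of a distributive bisemilattice, \<open>proj x y\<close> transports \<open>x\<close>
  to the fibre of \<open>x \<squnion> y\<close>.
\<close>

definition proj :: "'a \<Rightarrow> 'a \<Rightarrow> 'a" (infixl \<open>\<rhd>\<close> 68) where "x \<rhd> y = x \<squnion> down y"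

lemma up_closed [simp]: "x \<in> C \<Longrightarrow> up x \<in> C"
  and down_closed [simp]: "x \<in> C \<Longrightarrow> down x \<in> C"
  and proj_closed [simp]: "\<lbrakk>x \<in> C; y \<in> C\<rbrakk> \<Longrightarrow> x \<rhd> y \<in> C"
  by (simp_all add: up_def down_def proj_def)

lemma proj_eq_meet_join: "\<lbrakk>x \<in> C; y \<in> C\<rbrakk> \<Longrightarrow> x \<rhd> y = x \<sqinter> (x \<squnion> y)"
  by (simp add: proj_def down_def join_meet_distrib)

lemma proj_eq_join_meet: "\<lbrakk>x \<in> C; y \<in> C\<rbrakk> \<Longrightarrow> x \<rhd> y = x \<squnion> x \<sqinter> y"
  by (simp add: proj_eq_meet_join join_meet_distrib)

text \<open>Compared with the definition, this form shows that \<open>\<rhd>\<close> is self-dual: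
  it survives exchanging join with meet and \<open>down\<close> with \<open>up\<close>. Most later
  steps switch between the two forms.\<close>

lemma proj_eq_meet_up: "\<lbrakk>x \<in> C; y \<in> C\<rbrakk> \<Longrightarrow> x \<rhd> y = x \<sqinter> up y"
  by (simp add: proj_eq_join_meet up_def meet_join_distrib)

lemma join_down: "\<lbrakk>x \<in> C; y \<in> C\<rbrakk> \<Longrightarrow> x \<squnion> down y = x \<rhd> y"
  by (simp add: proj_def)

lemma meet_up: "\<lbrakk>x \<in> C; y \<in> C\<rbrakk> \<Longrightarrow> x \<sqinter> up y = x \<rhd> y"
  by (simp add: proj_eq_meet_up)

text \<open>Both sides are \<open>\<top> \<rhd> x\<close>, once in the join form and once in the
  meet form.\<close>

lemma up_down: "x \<in> C \<Longrightarrow> up (down x) = up x"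
  using meet_up[of \<top> x] join_down[of \<top> x] by (simp add: up_def)

lemma down_up: "x \<in> C \<Longrightarrow> down (up x) = down x"
  using meet_up[of \<bottom> x] join_down[of \<bottom> x] by (simp add: down_def)

lemma down_down: "x \<in> C \<Longrightarrow> down (down x) = down x"
  by (metis up_down down_up down_closed)

lemma up_up: "x \<in> C \<Longrightarrow> up (up x) = up x"
  by (metis up_down down_up up_closed)

lemma down_join: "\<lbrakk>x \<in> C; y \<in> C\<rbrakk> \<Longrightarrow> down (x \<squnion> y) = down x \<squnion> down y"
  by (simp add: down_def meet_join_distrib)

lemma up_meet: "\<lbrakk>x \<in> C; y \<in> C\<rbrakk> \<Longrightarrow> up (x \<sqinter> y) = up x \<sqinter> up y"
  by (simp add: up_def join_meet_distrib)

text \<open>Join and meet land in the same fibre. Since \<open>down\<close> factors through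
  \<open>up\<close>, the meet may be taken between \<open>up x\<close> and \<open>up y\<close>,
  where it is \<open>up x \<rhd> y\<close> and hence also the join
  \<open>up x \<squnion> down y\<close>.\<close>

lemma down_meet: "\<lbrakk>x \<in> C; y \<in> C\<rbrakk> \<Longrightarrow> down (x \<sqinter> y) = down (x \<squnion> y)"
proof -
  assume C: "x \<in> C" "y \<in> C"
  have "down (x \<sqinter> y) = down (up x \<sqinter> up y)"
    using C down_up[of "x \<sqinter> y"] by (simp add: up_meet)
  also have "up x \<sqinter> up y = up x \<squnion> down y"
    using C by (simp add: meet_up join_down)
  also have "down \<dots> = down (x \<squnion> y)"
    using C by (simp add: down_join down_up down_down)
  finally show ?thesis .
qed

lemma up_join: "\<lbrakk>x \<in> C; y \<in> C\<rbrakk> \<Longrightarrow> up (x \<squnion> y) = up x \<sqinter> up y"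
  using up_down[of "x \<squnion> y"] up_down[of "x \<sqinter> y"] by (simp add: up_meet down_meet)

lemma join_proj_right: "\<lbrakk>x \<in> C; y \<in> C\<rbrakk> \<Longrightarrow> (x \<squnion> y) \<rhd> y = x \<squnion> y"
  using join_meet_distrib[of y x \<top>] by (simp add: proj_eq_meet_up up_def join_comm)

lemma join_proj_left: "\<lbrakk>x \<in> C; y \<in> C\<rbrakk> \<Longrightarrow> (x \<squnion> y) \<rhd> x = x \<squnion> y"
  by (metis join_proj_right join_comm)

text \<open>Joining with the top of a fibre keeps only the fibre of \<open>x\<close>: meeting with
  \<open>up y\<close> does not change \<open>x \<squnion> up y\<close>, which is therefore
  \<open>up y \<rhd> x\<close>.\<close>

lemma join_up: "\<lbrakk>x \<in> C; y \<in> C\<rbrakk> \<Longrightarrow> x \<squnion> up y = up x \<sqinter> up y"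
proof -
  assume C: "x \<in> C" "y \<in> C"
  have "x \<squnion> up y = (x \<squnion> up y) \<sqinter> up y"
    using C join_proj_right[of x "up y"] by (simp add: proj_eq_meet_up up_up)
  also have "\<dots> = up y \<rhd> x"
    using C by (simp add: proj_eq_meet_join join_comm meet_comm)
  finally show ?thesis
    using C by (simp add: proj_eq_meet_up meet_comm)
qed

lemma proj_cong: "\<lbrakk>x \<in> C; down y = down z\<rbrakk> \<Longrightarrow> x \<rhd> y = x \<rhd> z"
  by (simp add: proj_def)

text \<open>Use the join form for the inner projection and the meet form for the outer one, then
  distribute; \<open>up z \<sqinter> down y\<close> is again a label, namely
  \<open>down (y \<squnion> z)\<close>.\<close>

lemma proj_proj: "\<lbrakk>x \<in> C; y \<in> C; z \<in> C\<rbrakk> \<Longrightarrow> (x \<rhd> y) \<rhd> z = (x \<rhd> z) \<rhd> (y \<squnion> z)"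
proof -
  assume C: "x \<in> C" "y \<in> C" "z \<in> C"
  have "(x \<rhd> y) \<rhd> z = (x \<rhd> y) \<sqinter> up z"
    using C by (simp add: proj_eq_meet_up[of "x \<rhd> y"])
  also have "\<dots> = up z \<sqinter> (x \<squnion> down y)"
    using C by (simp add: proj_def meet_comm)
  also have "\<dots> = up z \<sqinter> x \<squnion> up z \<sqinter> down y"
    using C by (simp add: meet_join_distrib)
  also have "up z \<sqinter> x = x \<rhd> z"
    using C by (simp add: proj_eq_meet_up meet_comm)
  also have "up z \<sqinter> down y = down (y \<squnion> z)"
    using C by (simp add: down_join meet_comm[of "up z"] meet_up join_down)
  finally show ?thesis
    by (simp add: proj_def)
qed

text \<open>Here the label \<open>down (y \<squnion> z)\<close> is split as
  \<open>down y \<sqinter> up z\<close>, and the join with \<open>x\<close> is distributed over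
  it.\<close>

lemma proj_join: "\<lbrakk>x \<in> C; y \<in> C; z \<in> C\<rbrakk> \<Longrightarrow> x \<rhd> (y \<squnion> z) = (x \<rhd> y) \<rhd> (x \<squnion> z)"
proof -
  assume C: "x \<in> C" "y \<in> C" "z \<in> C"
  have "down (y \<squnion> z) = down y \<sqinter> up z"
    using C by (simp add: down_join join_down meet_up)
  then have "x \<rhd> (y \<squnion> z) = x \<squnion> down y \<sqinter> up z"
    by (simp add: proj_def)
  also have "\<dots> = (x \<rhd> y) \<sqinter> (x \<squnion> up z)"
    using C by (simp add: join_meet_distrib proj_def)
  also have "\<dots> = (x \<rhd> y) \<sqinter> up (x \<squnion> z)"
    using C by (simp add: join_up up_join)
  finally show ?thesis
    using C by (simp add: meet_up)
qed

lemma proj_proj_left: "\<lbrakk>x \<in> C; y \<in> C\<rbrakk> \<Longrightarrow> (x \<rhd> y) \<rhd> x = x \<rhd> y"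
  unfolding proj_def[of x y] by (simp add: join_proj_left)

text \<open>
  On the elements of the form \<open>down x\<close> the projection is the join, so \<open>proj_join\<close> says that the
  join is self-distributive there.
\<close>

lemma down_join_assoc:
  assumes C: "x \<in> C" "y \<in> C" "z \<in> C"
  shows "down (x \<squnion> y \<squnion> z) = down (x \<squnion> (y \<squnion> z))"
proof -
  let ?D = "{p \<in> C. down p = p}"
  have dd: "p \<rhd> q = p \<squnion> q" if "q \<in> ?D" for p q
    using that by (simp add: proj_def)
  have cl: "p \<squnion> q \<in> ?D" if "p \<in> ?D" "q \<in> ?D" for p q
    using that by (simp add: down_join)
  have "(down x \<squnion> down y) \<squnion> down z = down x \<squnion> (down y \<squnion> down z)"
  proof (rule self_distributive_assoc[where D = ?D])
    fix p q r assume D: "p \<in> ?D" "q \<in> ?D" "r \<in> ?D"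
    then show "p \<squnion> (q \<squnion> r) = p \<squnion> q \<squnion> (p \<squnion> r)"
      using proj_join[of p q r] dd[OF D(2)] dd[OF cl[OF D(2,3)]] dd[OF cl[OF D(1,3)]] by simp
  next
    fix p q assume D: "p \<in> ?D" "q \<in> ?D"
    then show "p \<squnion> q = q \<squnion> p"
      by (simp add: join_comm)
    show "p \<squnion> (p \<squnion> q) = p \<squnion> q"
      using D proj_proj_left[of p q] dd[OF D(1)] dd[OF D(2)] join_comm[of p "p \<squnion> q"] by simp
  qed (use C cl in \<open>simp_all add: down_down\<close>)
  then show ?thesis
    using C by (simp add: down_join)
qed

text \<open>By \<open>proj_cong\<close> only \<open>down\<close> of the second argument matters, and
  there joins already associate. This shows that \<open>?w\<close> is unchanged by a further
  projection along \<open>z\<close>; then \<open>proj_proj\<close>, applied in both directions,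
  moves that projection into place.\<close>

lemma proj_assoc:
  assumes C: "x \<in> C" "y \<in> C" "z \<in> C"
  shows "(x \<rhd> y) \<rhd> z = x \<rhd> (y \<squnion> z)"
proof -
  let ?w = "x \<rhd> (y \<squnion> z)"
  have yzz: "down (y \<squnion> z \<squnion> z) = down (y \<squnion> z)"
    using C down_join_assoc[of y z z] by simp
  have wyz: "down (?w \<squnion> (y \<squnion> z)) = down ?w"
    using C down_join_assoc[of x "y \<squnion> z" "y \<squnion> z"] by (simp add: proj_def down_join down_down)
  have "?w = ?w \<rhd> (y \<squnion> z)"
    using C join_proj_right[of x "down (y \<squnion> z)"] by (simp add: proj_def down_down)
  also have "\<dots> = ?w \<rhd> (z \<squnion> (y \<squnion> z))"
    using C yzz join_comm[of z "y \<squnion> z"] by (intro proj_cong) simp_all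
  also have "\<dots> = (?w \<rhd> z) \<rhd> (?w \<squnion> (y \<squnion> z))"
    using C proj_join[of ?w z "y \<squnion> z"] by simp
  also have "\<dots> = (?w \<rhd> z) \<rhd> ?w"
    using C wyz by (intro proj_cong) simp_all
  also have "\<dots> = ?w \<rhd> z"
    using C by (simp add: proj_proj_left)
  also have "\<dots> = (x \<rhd> z) \<rhd> (y \<squnion> z \<squnion> z)"
    using C proj_proj[of x "y \<squnion> z" z] by simp
  also have "\<dots> = (x \<rhd> z) \<rhd> (y \<squnion> z)"
    using C yzz by (intro proj_cong) simp_all
  also have "\<dots> = (x \<rhd> y) \<rhd> z"
    using C proj_proj[of x y z] by simp
  finally show ?thesis by simp
qed

text \<open>After distributing, the factor \<open>x \<squnion> up z\<close> is the label
  \<open>up (x \<squnion> z)\<close>, and projecting \<open>x \<squnion> y\<close> along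
  \<open>x\<close> changes nothing.\<close>

lemma join_proj:
  assumes C: "x \<in> C" "y \<in> C" "z \<in> C"
  shows "x \<squnion> (y \<rhd> z) = (x \<squnion> y) \<rhd> z"
proof -
  have "x \<squnion> (y \<rhd> z) = (x \<squnion> y) \<sqinter> (x \<squnion> up z)"
    using C by (simp add: proj_eq_meet_up join_meet_distrib)
  also have "\<dots> = (x \<squnion> y) \<rhd> (x \<squnion> z)"
    using C by (simp add: join_up up_join proj_eq_meet_up)
  also have "\<dots> = (x \<squnion> y) \<rhd> z"
    using C by (simp add: proj_assoc[symmetric] join_proj_left)
  finally show ?thesis .
qed

lemma proj_join_eq:
  assumes C: "x \<in> C" "y \<in> C" "z \<in> C"
  shows "(y \<rhd> z) \<squnion> x = (y \<squnion> x) \<rhd> z"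
  using join_proj[of x y z] C by (simp add: join_comm)

text \<open>Distribute \<open>?t\<close> over the three summands of \<open>?s\<close>. Each meet is
  the summand projected along the other two variables; pulling the projections out of the joins
  leaves \<open>?s\<close> projected along its own variables, which is \<open>?s\<close>.\<close>

lemma assoc_meet:
  assumes C: "x \<in> C" "y \<in> C" "z \<in> C"
  shows "(x \<squnion> (y \<squnion> z)) \<sqinter> (x \<squnion> y \<squnion> z) = x \<squnion> y \<squnion> z"
proof -
  let ?t = "x \<squnion> (y \<squnion> z)" and ?s = "x \<squnion> y \<squnion> z"
  have sxy: "?s \<rhd> (x \<squnion> y) = ?s"
    using C by (simp add: join_proj_left)
  \<comment> \<open>By \<open>proj_assoc\<close>, \<open>?s\<close> is itself of the form
    \<open>_ \<rhd> p\<close>, and a second projection along \<open>p\<close> has no effect.\<close>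
  have s_left: "?s \<rhd> p = ?s" if "p \<in> C" "q \<in> C" "?s \<rhd> (q \<squnion> p) = ?s" for p q
  proof -
    have "(?s \<rhd> q) \<rhd> p = ?s"
      using C that by (simp add: proj_assoc)
    moreover have "((?s \<rhd> q) \<rhd> p) \<rhd> p = (?s \<rhd> q) \<rhd> p"
      using C that by (simp add: proj_assoc[of "?s \<rhd> q"])
    ultimately show ?thesis by simp
  qed
  have sx: "?s \<rhd> x = ?s" and sy: "?s \<rhd> y = ?s"
    using C sxy s_left[of x y] s_left[of y x] join_comm[of x y] by simp_all
  have sz: "?s \<rhd> z = ?s"
    using C by (simp add: join_proj_right)
  have x: "?t \<sqinter> x = x \<rhd> (y \<squnion> z)"
    using C by (simp add: proj_eq_meet_join meet_comm)
  have p: "(x \<squnion> (p \<squnion> q)) \<sqinter> p = p \<rhd> (x \<squnion> q)" if "p \<in> C" "q \<in> C" for p q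
  proof -
    have "(x \<squnion> (p \<squnion> q)) \<sqinter> p = p \<sqinter> (x \<squnion> (p \<squnion> q))"
      using C that by (simp add: meet_comm)
    also have "\<dots> = p \<sqinter> x \<squnion> p \<sqinter> (p \<squnion> q)"
      using C that by (simp add: meet_join_distrib[of p x])
    also have "\<dots> = (p \<sqinter> x \<squnion> p) \<rhd> q"
      using C that by (simp add: proj_eq_meet_join[symmetric] join_proj)
    also have "p \<sqinter> x \<squnion> p = p \<rhd> x"
      using C that by (simp add: proj_eq_join_meet join_comm)
    finally show ?thesis
      using C that by (simp add: proj_assoc)
  qed
  have y: "?t \<sqinter> y = y \<rhd> (x \<squnion> z)"
    using p[of y z] C by simp
  have z: "?t \<sqinter> z = z \<rhd> (x \<squnion> y)"
    using p[of z y] C by (simp add: join_comm[of z y])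
  have "?t \<sqinter> ?s = ?t \<sqinter> x \<squnion> ?t \<sqinter> y \<squnion> ?t \<sqinter> z"
    using C by (simp add: meet_join_distrib[of ?t])
  also have "\<dots> = x \<rhd> (y \<squnion> z) \<squnion> y \<rhd> (x \<squnion> z) \<squnion> z \<rhd> (x \<squnion> y)"
    by (simp only: x y z)
  also have "\<dots> = ((?s \<rhd> (y \<squnion> z)) \<rhd> (x \<squnion> z)) \<rhd> (x \<squnion> y)"
    using C by (simp add: join_proj proj_join_eq)
  also have "\<dots> = ?s"
    using C by (simp add: proj_assoc[symmetric] sx sy sz)
  finally show ?thesis .
qed

lemma join_assoc:
  assumes C: "x \<in> C" "y \<in> C" "z \<in> C"
  shows "x \<squnion> y \<squnion> z = x \<squnion> (y \<squnion> z)"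
proof -
  let ?t = "x \<squnion> (y \<squnion> z)" and ?s = "x \<squnion> y \<squnion> z"
  \<comment> \<open>Reversing the order of the variables exchanges \<open>?s\<close> and
    \<open>?t\<close>, so \<open>assoc_meet\<close> evaluates their meet to either of them.\<close>
  have "z \<squnion> (y \<squnion> x) = ?s" "z \<squnion> y \<squnion> x = ?t"
    using C join_comm[of z "y \<squnion> x"] join_comm[of "z \<squnion> y" x] join_comm[of y x] join_comm[of z y]
    by simp_all
  then have "?s \<sqinter> ?t = ?t"
    using assoc_meet[of z y x] C by simp
  then show ?thesis
    using assoc_meet[of x y z] meet_comm[of ?s ?t] C by simp
qed

end

section \<open>Symmetric implication zroupoids as bisemilattices\<close>

locale I_zroupoid =
  fixes A :: "'a zroupoid" (structure)
  assumes I_zroupoid: "is_I_zroupoid A"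
begin

lemma zero_closed [simp]: "\<zero> \<in> carrier A"
  and imp_closed [simp]: "\<lbrakk>x \<in> carrier A; y \<in> carrier A\<rbrakk> \<Longrightarrow> x \<rightarrow> y \<in> carrier A"
  and imp_zero: "x \<rightarrow> \<zero> = x\<acute>"
  and imp_imp: "\<lbrakk>x \<in> carrier A; y \<in> carrier A; z \<in> carrier A\<rbrakk> \<Longrightarrow>
        (x \<rightarrow> y) \<rightarrow> z = ((z\<acute> \<rightarrow> x) \<rightarrow> (y \<rightarrow> z)\<acute>)\<acute>"
  using I_zroupoid unfolding is_I_zroupoid_def is_zroupoid_def
  by (blast, blast, simp add: neg_def, blast)

lemma neg_closed [simp]: "x \<in> carrier A \<Longrightarrow> x\<acute> \<in> carrier A"
  by (simp add: neg_def)

end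

locale symmetric_I_zroupoid =
  fixes A :: "'a zroupoid" (structure)
  assumes in_var_S: "A \<in> var_S"
begin

sublocale I_zroupoid A
  using in_var_S by unfold_locales (simp add: var_S_def)

lemma neg_neg [simp]: "x \<in> carrier A \<Longrightarrow> x\<acute>\<acute> = x"
  using in_var_S by (simp add: var_S_def)

lemma contrapos:
  assumes C: "x \<in> carrier A" "y \<in> carrier A"
  shows "x \<rightarrow> y\<acute> = y \<rightarrow> x\<acute>"
proof -
  have "(x \<rightarrow> y\<acute>)\<acute> = (y \<rightarrow> x\<acute>)\<acute>"
    using in_var_S C unfolding var_S_def by blast
  then have "(x \<rightarrow> y\<acute>)\<acute>\<acute> = (y \<rightarrow> x\<acute>)\<acute>\<acute>"
    by (rule arg_cong)
  then show ?thesis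
    using C by simp
qed

definition join :: "'a \<Rightarrow> 'a \<Rightarrow> 'a" (infixl \<open>\<squnion>\<close> 68) where "x \<squnion> y = x\<acute> \<rightarrow> y"
definition meet :: "'a \<Rightarrow> 'a \<Rightarrow> 'a" (infixl \<open>\<sqinter>\<close> 70) where "x \<sqinter> y = (x \<rightarrow> y\<acute>)\<acute>"

lemma imp_eq_join: "x \<in> carrier A \<Longrightarrow> x \<rightarrow> y = x\<acute> \<squnion> y"
  by (simp add: join_def)

lemma neg_join: "\<lbrakk>x \<in> carrier A; y \<in> carrier A\<rbrakk> \<Longrightarrow> (x \<squnion> y)\<acute> = x\<acute> \<sqinter> y\<acute>"
  by (simp add: join_def meet_def)

text \<open>Axiom (I) is the distributivity of join over meet, up to commutativity.\<close>

sublocale weak_bisemilattice "carrier A" "(\<squnion>)" "(\<sqinter>)" \<zero> "\<zero>\<acute>"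
proof
  fix x y z
  assume C: "x \<in> carrier A" "y \<in> carrier A" "z \<in> carrier A"
  have join_comm: "p \<squnion> q = q \<squnion> p" if "p \<in> carrier A" "q \<in> carrier A" for p q
    using contrapos[of "p\<acute>" "q\<acute>"] that by (simp add: join_def)
  have join_meet: "p \<squnion> q \<sqinter> r = (p \<squnion> q) \<sqinter> (p \<squnion> r)"
    if "p \<in> carrier A" "q \<in> carrier A" "r \<in> carrier A" for p q r
  proof -
    have "q \<sqinter> r \<squnion> p = (p \<squnion> q) \<sqinter> (r \<squnion> p)"
      using imp_imp[of q "r\<acute>" p] that by (simp add: join_def meet_def)
    then show ?thesis
      using that join_comm[of p "q \<sqinter> r"] join_comm[of p r] by (simp add: meet_def)
  qed
  show "x \<squnion> y \<sqinter> z = (x \<squnion> y) \<sqinter> (x \<squnion> z)"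
    using C by (rule join_meet)
  \<comment> \<open>The dual law is the first one at negated arguments, negated.\<close>
  have "x\<acute> \<squnion> y\<acute> \<sqinter> z\<acute> = (x\<acute> \<squnion> y\<acute>) \<sqinter> (x\<acute> \<squnion> z\<acute>)"
    using C by (simp add: join_meet)
  then have "(x\<acute> \<squnion> y\<acute> \<sqinter> z\<acute>)\<acute> = ((x\<acute> \<squnion> y\<acute>) \<sqinter> (x\<acute> \<squnion> z\<acute>))\<acute>"
    by simp
  then show "x \<sqinter> (y \<squnion> z) = x \<sqinter> y \<squnion> x \<sqinter> z"
    using C by (simp add: join_def meet_def)
  show "x \<squnion> y = y \<squnion> x"
    using C by (intro join_comm)
  show "x \<sqinter> y = y \<sqinter> x"
    using C contrapos[of x y] by (simp add: meet_def)
qed (simp_all add: join_def meet_def imp_zero)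

section \<open>The Bol-Moufang identities in terms of join and meet\<close>

lemma join_left_comm:
  assumes "x \<in> carrier A" "y \<in> carrier A" "z \<in> carrier A"
  shows "x \<squnion> (y \<squnion> z) = y \<squnion> (x \<squnion> z)"
  using assms join_assoc[of x y z] join_assoc[of y x z] join_comm[of x y] by simp

lemmas join_ac = join_assoc join_comm join_left_comm

lemma join_left_idem [simp]: "\<lbrakk>x \<in> carrier A; y \<in> carrier A\<rbrakk> \<Longrightarrow> x \<squnion> (x \<squnion> y) = x \<squnion> y"
  by (simp flip: join_assoc)

text \<open>Associativity splits off \<open>z\<close> as a common summand of both sides, and
  \<open>z = 0\<close> removes it. The same argument handles (A23).\<close>

lemma in_var_A12_iff:
  "A \<in> var_A12 \<longleftrightarrow> (\<forall>x\<in>carrier A. \<forall>y\<in>carrier A. x \<squnion> x\<acute> \<sqinter> y = x \<squnion> y)"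
proof
  assume A12: "A \<in> var_A12"
  show "\<forall>x\<in>carrier A. \<forall>y\<in>carrier A. x \<squnion> x\<acute> \<sqinter> y = x \<squnion> y"
  proof (intro ballI)
    fix x y assume C: "x \<in> carrier A" "y \<in> carrier A"
    have "x\<acute> \<rightarrow> (x\<acute> \<rightarrow> (y\<acute> \<rightarrow> \<zero>)) = x\<acute> \<rightarrow> ((x\<acute> \<rightarrow> y\<acute>) \<rightarrow> \<zero>)"
      using A12 C by (simp add: var_A12_def)
    then show "x \<squnion> x\<acute> \<sqinter> y = x \<squnion> y"
      using C by (simp add: imp_eq_join neg_join)
  qed
next
  assume *: "\<forall>x\<in>carrier A. \<forall>y\<in>carrier A. x \<squnion> x\<acute> \<sqinter> y = x \<squnion> y"
  have "x \<rightarrow> (x \<rightarrow> (y \<rightarrow> z)) = x \<rightarrow> ((x \<rightarrow> y) \<rightarrow> z)"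
    if C: "x \<in> carrier A" "y \<in> carrier A" "z \<in> carrier A" for x y z
  proof -
    have "x\<acute> \<squnion> x \<sqinter> y\<acute> = x\<acute> \<squnion> y\<acute>"
      using *[rule_format, of "x\<acute>" "y\<acute>"] C by simp
    then show ?thesis
      using C by (simp add: imp_eq_join neg_join flip: join_assoc)
  qed
  then show "A \<in> var_A12"
    using in_var_S by (simp add: var_A12_def)
qed

lemma in_var_A23_iff:
  "A \<in> var_A23 \<longleftrightarrow> (\<forall>x\<in>carrier A. \<forall>y\<in>carrier A. x \<squnion> x\<acute> \<sqinter> y = x \<sqinter> x\<acute> \<squnion> y)"
proof
  assume A23: "A \<in> var_A23"
  show "\<forall>x\<in>carrier A. \<forall>y\<in>carrier A. x \<squnion> x\<acute> \<sqinter> y = x \<sqinter> x\<acute> \<squnion> y"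
  proof (intro ballI)
    fix x y assume C: "x \<in> carrier A" "y \<in> carrier A"
    have "x\<acute> \<rightarrow> ((x\<acute> \<rightarrow> y\<acute>) \<rightarrow> \<zero>) = (x\<acute> \<rightarrow> x\<acute>) \<rightarrow> (y\<acute> \<rightarrow> \<zero>)"
      using A23 C by (simp add: var_A23_def)
    then show "x \<squnion> x\<acute> \<sqinter> y = x \<sqinter> x\<acute> \<squnion> y"
      using C by (simp add: imp_eq_join neg_join meet_comm)
  qed
next
  assume *: "\<forall>x\<in>carrier A. \<forall>y\<in>carrier A. x \<squnion> x\<acute> \<sqinter> y = x \<sqinter> x\<acute> \<squnion> y"
  have "x \<rightarrow> ((x \<rightarrow> y) \<rightarrow> z) = (x \<rightarrow> x) \<rightarrow> (y \<rightarrow> z)"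
    if C: "x \<in> carrier A" "y \<in> carrier A" "z \<in> carrier A" for x y z
  proof -
    have "x\<acute> \<squnion> x \<sqinter> y\<acute> = x \<sqinter> x\<acute> \<squnion> y\<acute>"
      using *[rule_format, of "x\<acute>" "y\<acute>"] C by (simp add: meet_comm)
    then show ?thesis
      using C by (simp add: imp_eq_join neg_join flip: join_assoc)
  qed
  then show "A \<in> var_A23"
    using in_var_S by (simp add: var_A23_def)
qed

text \<open>The right side of (F25) is
  \<open>z \<squnion> z\<acute> \<sqinter> (x\<acute> \<squnion> y)\<close>; distributing and
  duplicating \<open>z\<close> by idempotence brings it to the shape of the assumption.\<close>

lemma in_var_F25_if:
  assumes "\<And>x y z. \<lbrakk>x \<in> carrier A; y \<in> carrier A; z \<in> carrier A\<rbrakk> \<Longrightarrow>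
    x \<squnion> (z \<squnion> z\<acute> \<sqinter> y) = (z \<squnion> z\<acute> \<sqinter> x) \<squnion> (z \<squnion> z\<acute> \<sqinter> y)"
  shows "A \<in> var_F25"
proof -
  have "x \<rightarrow> ((y \<rightarrow> z) \<rightarrow> z) = ((x \<rightarrow> y) \<rightarrow> z) \<rightarrow> z"
    if C: "x \<in> carrier A" "y \<in> carrier A" "z \<in> carrier A" for x y z
  proof -
    have "x \<rightarrow> ((y \<rightarrow> z) \<rightarrow> z) = x\<acute> \<squnion> (y \<sqinter> z\<acute> \<squnion> z)"
      using C by (simp add: imp_eq_join neg_join)
    also have "\<dots> = x\<acute> \<squnion> (z \<squnion> z\<acute> \<sqinter> y)"
      using C join_comm[of "y \<sqinter> z\<acute>" z] meet_comm[of y "z\<acute>"] by simp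
    also have "\<dots> = (z \<squnion> z\<acute> \<sqinter> x\<acute>) \<squnion> (z \<squnion> z\<acute> \<sqinter> y)"
      using C by (intro assms) simp_all
    also have "\<dots> = z \<squnion> (z\<acute> \<sqinter> x\<acute> \<squnion> z\<acute> \<sqinter> y)"
      using C by (simp add: join_ac)
    also have "\<dots> = z \<squnion> z\<acute> \<sqinter> (x\<acute> \<squnion> y)"
      using C by (simp add: meet_join_distrib)
    also have "\<dots> = ((x \<rightarrow> y) \<rightarrow> z) \<rightarrow> z"
      using C join_comm[of z "z\<acute> \<sqinter> (x\<acute> \<squnion> y)"] meet_comm[of "z\<acute>"]
      by (simp add: imp_eq_join neg_join[of _ z])
    finally show ?thesis .
  qed
  then show ?thesis
    using in_var_S by (simp add: var_F25_def)
qed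

text \<open>Both sides collapse to the join of \<open>x\<close>, \<open>y\<close> and
  \<open>z\<close>.\<close>

lemma A12_imp_F25: "A \<in> var_A12 \<Longrightarrow> A \<in> var_F25"
  by (rule in_var_F25_if) (simp add: in_var_A12_iff join_ac)

lemma A23_imp_F25:
  assumes A23: "A \<in> var_A23"
  shows "A \<in> var_F25"
proof (rule in_var_F25_if)
  fix x y z assume C: "x \<in> carrier A" "y \<in> carrier A" "z \<in> carrier A"
  \<comment> \<open>Now both sides become the join of \<open>z \<sqinter> z\<acute>\<close>,
    \<open>x\<close> and \<open>y\<close>.\<close>
  have z: "z \<squnion> z\<acute> \<sqinter> p = z \<sqinter> z\<acute> \<squnion> p" if "p \<in> carrier A" for p
    using A23 C that by (simp add: in_var_A23_iff)
  show "x \<squnion> (z \<squnion> z\<acute> \<sqinter> y) = (z \<squnion> z\<acute> \<sqinter> x) \<squnion> (z \<squnion> z\<acute> \<sqinter> y)"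
    using C by (simp add: z join_ac)
qed

lemma A12_A23_imp_SL:
  assumes "A \<in> var_A12" "A \<in> var_A23"
  shows "A \<in> var_SL"
proof -
  have neg: "x\<acute> = x" if x: "x \<in> carrier A" for x
  proof -
    have m: "p \<sqinter> p\<acute> = p" if "p \<in> carrier A" for p
    proof -
      have "p \<squnion> p\<acute> \<sqinter> \<zero> = p \<squnion> \<zero>" "p \<squnion> p\<acute> \<sqinter> \<zero> = p \<sqinter> p\<acute> \<squnion> \<zero>"
        using assms that in_var_A12_iff in_var_A23_iff zero_closed by blast+
      then show ?thesis
        using that by simp
    qed
    show ?thesis
      using x m[of x] m[of "x\<acute>"] meet_comm[of x "x\<acute>"] by simp
  qed
  then have "x \<rightarrow> y = y \<rightarrow> x" if "x \<in> carrier A" "y \<in> carrier A" for x y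
    using that join_comm[of x y] by (simp add: imp_eq_join)
  with neg show ?thesis
    using I_zroupoid by (simp add: var_SL_def)
qed

end

section \<open>Semilattices and Boolean algebras inside the symmetric variety\<close>

lemma SL_imp_S: "A \<in> var_SL \<Longrightarrow> A \<in> var_S"
proof -
  assume SL: "A \<in> var_SL"
  then interpret I_zroupoid A
    by unfold_locales (simp add: var_SL_def)
  show ?thesis
    using SL by (simp add: var_SL_def var_S_def)
qed

text \<open>With trivial negation, join and meet are one semilattice operation, and both identities
  reduce to idempotence.\<close>

lemma SL_imp_A12_A23:
  assumes "A \<in> var_SL"
  shows "A \<in> var_A12" "A \<in> var_A23"
proof -
  interpret symmetric_I_zroupoid A
    using assms by unfold_locales (rule SL_imp_S)
  have neg: "neg A x = x" if "x \<in> carrier A" for x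
    using assms that by (simp add: var_SL_def)
  then have "meet x y = join x y" if "x \<in> carrier A" "y \<in> carrier A" for x y
    using that by (simp add: meet_def join_def)
  then show "A \<in> var_A12" "A \<in> var_A23"
    unfolding in_var_A12_iff in_var_A23_iff by (simp_all add: neg)
qed

lemma BA_imp_S:
  assumes BA: "A \<in> var_BA"
  shows "A \<in> var_S"
proof -
  interpret I_zroupoid A
    using assms by unfold_locales (simp add: var_BA_def)
  note [simp] = imp_zero
  have absorb: "imp A (imp A x y) x = x" if "x \<in> carrier A" "y \<in> carrier A" for x y
    using BA that by (simp add: var_BA_def)
  \<comment> \<open>Absorption gives \<open>x' \<rightarrow> x = x\<close> and
    \<open>x \<rightarrow> x' = x'\<close>, so (I) at \<open>x\<close>, \<open>x'\<close>,
    \<open>x\<close> collapses to \<open>x = x''\<close>.\<close>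
  have inv: "neg A (neg A x) = x" if "x \<in> carrier A" for x
    using imp_imp[of x "neg A x" x] absorb[of x "neg A x"] absorb[of x "zero A"] absorb[of "neg A x" x] that
    by simp
  have zero_imp: "imp A (zero A) y = neg A (zero A)" if "y \<in> carrier A" for y
    using absorb[of "zero A" y] inv[of "imp A (zero A) y"] that by simp
  \<comment> \<open>With middle argument 0, the right side of (I) is a double negation of
    \<open>y \<rightarrow> x'\<close>, because \<open>0 \<rightarrow> y' = 0'\<close>.\<close>
  have "imp A x (neg A y) = imp A y (neg A x)" if "x \<in> carrier A" "y \<in> carrier A" for x y
    using imp_imp[of "neg A x" "zero A" "neg A y"] that by (simp add: zero_imp inv)
  then show ?thesis
    using I_zroupoid inv by (auto simp: var_S_def)
qed

text \<open>The law \<open>x \<rightarrow> x = 0'\<close> says that \<open>x'\<close> is a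
  complement of \<open>x\<close> for the join, so distributing
  \<open>x \<squnion> x' \<sqinter> y\<close> leaves \<open>x \<squnion> y\<close>.\<close>

lemma BA_imp_A12:
  assumes BA: "A \<in> var_BA"
  shows "A \<in> var_A12"
proof -
  interpret symmetric_I_zroupoid A
    using assms by unfold_locales (rule BA_imp_S)
  have "join x (neg A x) = neg A (zero A)" if "x \<in> carrier A" for x
    using BA that by (simp add: var_BA_def join_def)
  then show ?thesis
    unfolding in_var_A12_iff by (simp add: join_meet_distrib dual.bot_join)
qed


lemma var_A12_subset_var_S: "var_A12 \<subseteq> var_S"
  and var_A23_subset_var_S: "var_A23 \<subseteq> var_S"
  and var_F25_subset_var_S: "var_F25 \<subseteq> var_S"
  by (auto simp: var_A12_def var_A23_def var_F25_def)

lemma var_A12_subset_var_F25: "var_A12 \<subseteq> var_F25"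
  using symmetric_I_zroupoid.A12_imp_F25 var_A12_subset_var_S
  by (auto simp: symmetric_I_zroupoid_def)

lemma var_A23_subset_var_F25: "var_A23 \<subseteq> var_F25"
  using symmetric_I_zroupoid.A23_imp_F25 var_A23_subset_var_S
  by (auto simp: symmetric_I_zroupoid_def)

lemma var_SL_eq: "var_SL = var_A23 \<inter> var_A12"
  using SL_imp_A12_A23 symmetric_I_zroupoid.A12_A23_imp_SL var_A12_subset_var_S
  by (auto simp: symmetric_I_zroupoid_def)

lemma var_BA_subset_var_A12: "var_BA \<subseteq> var_A12"
  using BA_imp_A12 by blast

section \<open>Transport along injections and finite witnesses\<close>

definition embed :: "('b \<Rightarrow> 'a) \<Rightarrow> 'b zroupoid \<Rightarrow> 'a zroupoid" where
  "embed e B = \<lparr>carrier = e ` carrier B, imp = (\<lambda>x y. e (imp B (inv e x) (inv e y))), zero = e (zero B)\<rparr>"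

context
  fixes e :: "'b \<Rightarrow> 'a"
  assumes e: "inj e"
begin

lemma embed_simps:
  "carrier (embed e B) = e ` carrier B" "zero (embed e B) = e (zero B)"
  "imp (embed e B) (e x) (e y) = e (imp B x y)" "neg (embed e B) (e x) = e (neg B x)"
  using e by (simp_all add: embed_def neg_def)

lemma embed_eq_iff: "e x = e y \<longleftrightarrow> x = y"
  using e by (simp add: inj_eq)

lemma embed_in_iff: "e x \<in> e ` C \<longleftrightarrow> x \<in> C"
  using e by (simp add: inj_image_mem_iff)

text \<open>Rewriting with these pulls every quantifier, operation and equation back along
  \<open>e\<close>, until both sides of each equivalence below are the same formula.\<close>

lemmas embed_transfer = embed_simps embed_eq_iff embed_in_iff ball_simps(9)

lemma embed_I_zroupoid_iff: "is_I_zroupoid (embed e B) \<longleftrightarrow> is_I_zroupoid B"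
  unfolding is_I_zroupoid_def is_zroupoid_def embed_transfer ..

lemma embed_S_iff: "embed e B \<in> var_S \<longleftrightarrow> B \<in> var_S"
  unfolding var_S_def mem_Collect_eq embed_transfer embed_I_zroupoid_iff ..

lemma embed_SL_iff: "embed e B \<in> var_SL \<longleftrightarrow> B \<in> var_SL"
  unfolding var_SL_def mem_Collect_eq embed_transfer embed_I_zroupoid_iff ..

lemma embed_BA_iff: "embed e B \<in> var_BA \<longleftrightarrow> B \<in> var_BA"
  unfolding var_BA_def mem_Collect_eq embed_transfer embed_I_zroupoid_iff ..

lemma embed_A12_iff: "embed e B \<in> var_A12 \<longleftrightarrow> B \<in> var_A12"
  unfolding var_A12_def mem_Collect_eq embed_transfer embed_S_iff ..

lemma embed_A23_iff: "embed e B \<in> var_A23 \<longleftrightarrow> B \<in> var_A23"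
  unfolding var_A23_def mem_Collect_eq embed_transfer embed_S_iff ..

lemma embed_F25_iff: "embed e B \<in> var_F25 \<longleftrightarrow> B \<in> var_F25"
  unfolding var_F25_def mem_Collect_eq embed_transfer embed_S_iff ..

end

text \<open>The carrier is the set of an interval list so that the simplifier can expand the
  quantifiers into finitely many table lookups.\<close>

definition table_zroupoid :: "nat list list \<Rightarrow> nat zroupoid" where
  "table_zroupoid t = \<lparr>carrier = set [0..<length t], imp = (\<lambda>x y. t ! x ! y), zero = 0\<rparr>"

definition semilattice2 :: "nat zroupoid" where
  "semilattice2 = table_zroupoid [[0, 1], [1, 1]]"
definition boolean2 :: "nat zroupoid" where
  "boolean2 = table_zroupoid [[1, 1], [0, 1]]"
text \<open>Strong Kleene implication on the chain 0 < 2 < 1 with \<open>2' = 2\<close>. At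
  \<open>x = 0\<close>, \<open>z = 2\<close> the two sides of (F25) are 1 and 2.\<close>

definition kleene3 :: "nat zroupoid" where
  "kleene3 = table_zroupoid [[1, 1, 1], [0, 1, 2], [2, 1, 2]]"
text \<open>Join and meet coincide here: a semilattice with unit 0, absorbing element 1 and
  \<open>2 \<squnion> 3 = 1\<close>, whose negation swaps 2 and 3. Hence (A23) is immediate, while
  \<open>x = 2\<close>, \<open>y = 0\<close> violates
  \<open>x \<squnion> x' \<sqinter> y = x \<squnion> y\<close>.\<close>

definition bisemilattice4 :: "nat zroupoid" where
  "bisemilattice4 = table_zroupoid [[0, 1, 2, 3], [1, 1, 1, 1], [3, 1, 1, 3], [2, 1, 2, 1]]"

lemmas variety_defs = table_zroupoid_def neg_def is_zroupoid_def is_I_zroupoid_def var_S_def var_SL_def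
  var_BA_def var_A12_def var_A23_def var_F25_def

lemma semilattice2: "semilattice2 \<in> var_SL" "semilattice2 \<notin> var_BA"
  by (simp_all add: semilattice2_def variety_defs upt_rec numeral_eq_Suc)

lemma boolean2: "boolean2 \<in> var_A12" "boolean2 \<notin> var_A23"
  by (simp_all add: boolean2_def variety_defs upt_rec numeral_eq_Suc)

lemma kleene3: "kleene3 \<in> var_S" "kleene3 \<notin> var_F25"
  by (simp_all add: kleene3_def variety_defs upt_rec numeral_eq_Suc)

lemma bisemilattice4: "bisemilattice4 \<in> var_A23" "bisemilattice4 \<notin> var_A12"
  by (simp_all add: bisemilattice4_def variety_defs upt_rec numeral_eq_Suc)

theorem theorem4p2:
  shows "(\<forall>V \<in> {var_SL, var_A12, var_A23, var_F25, var_S :: 'a::infinite zroupoid set}. nontrivial V) \<and>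
    distinct [var_SL, var_A12, var_A23, var_F25, var_S :: 'a zroupoid set] \<and>
    ((var_SL :: 'a zroupoid set) \<subset> var_A23 \<and> (var_A23 :: 'a zroupoid set) \<subset> var_F25) \<and>
    (var_SL :: 'a zroupoid set) \<subset> var_A12 \<and>
    ((var_BA :: 'a zroupoid set) \<subset> var_A12 \<and> (var_A12 :: 'a zroupoid set) \<subset> var_F25) \<and>
    (var_F25 :: 'a zroupoid set) \<subset> var_S \<and>
    (var_SL :: 'a zroupoid set) = var_A23 \<inter> var_A12"
proof -
  obtain e :: "nat \<Rightarrow> 'a" where e: "inj e"
    using infinite_UNIV infinite_countable_subset by blast
  note iffs = embed_S_iff[OF e] embed_SL_iff[OF e] embed_BA_iff[OF e] embed_A12_iff[OF e]
    embed_A23_iff[OF e] embed_F25_iff[OF e]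
  note witnesses = semilattice2 boolean2 kleene3 bisemilattice4
  have strict: "V \<subset> W" if "V \<subseteq> W" "A \<in> W" "A \<notin> V"
    for V W and A :: "'a zroupoid"
    using that by blast
  \<comment> \<open>By \<open>var_SL_eq\<close>, a member of one of the two varieties that fails the
    other identity lies outside \<open>var_SL\<close>.\<close>
  have SL_A23: "(var_SL :: 'a zroupoid set) \<subset> var_A23"
    using witnesses by (intro strict[of _ _ "embed e bisemilattice4"]) (auto simp: iffs var_SL_eq)
  have SL_A12: "(var_SL :: 'a zroupoid set) \<subset> var_A12"
    using witnesses by (intro strict[of _ _ "embed e boolean2"]) (auto simp: iffs var_SL_eq)
  have A23_F25: "(var_A23 :: 'a zroupoid set) \<subset> var_F25"
    using witnesses var_A12_subset_var_F25
    by (intro strict[of _ _ "embed e boolean2"] var_A23_subset_var_F25) (auto simp: iffs)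
  have A12_F25: "(var_A12 :: 'a zroupoid set) \<subset> var_F25"
    using witnesses var_A23_subset_var_F25
    by (intro strict[of _ _ "embed e bisemilattice4"] var_A12_subset_var_F25) (auto simp: iffs)
  have F25_S: "(var_F25 :: 'a zroupoid set) \<subset> var_S"
    using witnesses
    by (intro strict[of _ _ "embed e kleene3"] var_F25_subset_var_S) (auto simp: iffs)
  have BA_A12: "(var_BA :: 'a zroupoid set) \<subset> var_A12"
    using witnesses
    by (intro strict[of _ _ "embed e semilattice2"] var_BA_subset_var_A12) (auto simp: iffs var_SL_eq)
  \<comment> \<open>This is the only one of the ten pairs not separated by a chain of strict
    inclusions.\<close>
  have A12_A23: "(var_A12 :: 'a zroupoid set) \<noteq> var_A23"
    using witnesses iffs by metis
  \<comment> \<open>A two-element member of the smallest of the five varieties makes all of them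
    nontrivial.\<close>
  have "embed e semilattice2 \<in> var_SL" "e 0 \<in> carrier (embed e semilattice2)"
    "e 1 \<in> carrier (embed e semilattice2)" "e 0 \<noteq> e 1"
    using witnesses e by (auto simp: iffs embed_simps[OF e] inj_eq semilattice2_def table_zroupoid_def)
  then have nontrivial: "nontrivial V" if "var_SL \<subseteq> V" for V :: "'a zroupoid set"
    using that unfolding nontrivial_def by blast
  show ?thesis
    using SL_A23 SL_A12 A23_F25 A12_F25 F25_S BA_A12 A12_A23 var_SL_eq
    by (auto intro!: nontrivial)
qed

end
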